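(* Let $h:\mathbb{R}\to\mathbb{R}^+$ be a growth rate, $X$ a Banach space, and $U=\{U(t_0,s_0)\}_{t_0\ge s_0}$ an $h$-bounded $h$-evolution family on $X$. Let $\mu:\mathbb{R}_*\to\mathbb{R}$, $\mu(t)=\ln(h(t))$, and let $\mathcal{F}:C_0(\mathbb{R}_*,X)\to C_0(\mathbb{R},X)$, $\mathcal{F}(w)=w\circ\mu^{-1}$. Let $\{T_{t_0}\}_{t_0\ge e_*}$ be the evolution $h$-semigroup on $C_0(\mathbb{R}_*,X)$ associated with $U$, and let $\{S_t\}_{t\ge0}$ be the evolution semigroup on $C_0(\mathbb{R},X)$ associated with the evolution family $V(t,s)=U(\mu^{-1}(t),\mu^{-1}(s))$, $t\ge s$, with generator $(A,D(A))$. Then the $h$-generator $B_h$ of $\{T_{t_0}\}_{t_0\ge e_*}$ is given by $$B_hw=(\mathcal{F}^{-1}A\mathcal{F})w=A(w\circ\mu^{-1})\circ\mu$$ with domain $$D(B_h)=\{w\in C_0(\mathbb{R}_*,X):\ w\circ\mu^{-1}\in D(A)\}.$$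
   Context: A growth rate is a strictly increasing homeomorphism $h:\mathbb{R}\to\mathbb{R}^+=(0,\infty)$. It induces on $\mathbb{R}$ the abelian group law $t*_h s:=h^{-1}(h(t)h(s))$, with neutral element $e_*:=h^{-1}(1)$ and inverse $t^{*-1}:=h^{-1}(1/h(t))$. $\mathbb{R}_*$ denotes $\mathbb{R}$ with this structure; its order and topology are the usual ones of $\mathbb{R}$. $C_0(\mathbb{R}_*,X)$ (resp. $C_0(\mathbb{R},X)$) is the Banach space of continuous $X$-valued functions on $\mathbb{R}_*$ (resp. $\mathbb{R}$) vanishing at $\pm\infty$, with the sup norm. An $h$-evolution family on $X$ is a collection $\{U(t,s)\}_{t\ge s}$ ($t,s\in\mathbb{R}_*$) of bounded linear operators on $X$ with $U(t,t)=\mathrm{Id}$, $U(t,\tau)U(\tau,s)=U(t,s)$ for $t\ge\tau\ge s$, and $(t,s)\mapsto U(t,s)x$ continuous on $\{t\ge s\}$ for each $x\in X$. It is $h$-bounded if there are $\alpha>0$, $K\ge1$ with $\|U(t,s)\|\le K\,(h(t)/h(s))^{\alpha}$ for all $t\ge s$. The evolution $h$-semigroup associated with $U$: for $t\ge e_*$, $(T_tu)(s):=U(s,s*_h t^{*-1})\,u(s*_h t^{*-1})$, $u\in C_0(\mathbb{R}_*,X)$. Its ($h$-)generator is $B_hw=\lim_{t\to e_*^+}\frac{T_tw-w}{\ln(h(t))}$ (limit in $C_0(\mathbb{R}_*,X)$), with domain $D(B_h)$ the set of $w$ for which this limit exists. The evolution semigroup associated with $V$: for $t\ge0$, $(S_tv)(s)=V(s,s-t)\,v(s-t)$,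 $v\in C_0(\mathbb{R},X)$, $s\in\mathbb{R}$. Its generator is $Av=\lim_{t\to0^+}\frac{S_tv-v}{t}$ (limit in $C_0(\mathbb{R},X)$) with domain $D(A)$ the set of $v$ for which this limit exists. *)

theory Defs
  imports "HOL-Analysis.Analysis"
begin

section \<open>Growth rates and the induced group law on the real line\<close>

definition growth_rate :: "(real \<Rightarrow> real) \<Rightarrow> bool" where
  "growth_rate h \<longleftrightarrow> strict_mono h \<and> homeomorphism UNIV {0<..} h (inv h)"

definition hmult :: "(real \<Rightarrow> real) \<Rightarrow> real \<Rightarrow> real \<Rightarrow> real" where
  "hmult h t s = inv h (h t * h s)"

definition hunit :: "(real \<Rightarrow> real) \<Rightarrow> real" where
  "hunit h = inv h 1"

definition hinv :: "(real \<Rightarrow> real) \<Rightarrow> real \<Rightarrow> real" where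
  "hinv h t = inv h (1 / h t)"

definition log_rate :: "(real \<Rightarrow> real) \<Rightarrow> real \<Rightarrow> real" where
  "log_rate h t = ln (h t)"


section \<open>Continuous functions vanishing at infinity\<close>

text \<open>
  The norm of \<^typ>\<open>real \<Rightarrow>\<^sub>C 'a\<close> is the sup norm. Since the group structure
  induced by a growth rate keeps the order and topology of the reals, the same set serves
  for functions on the real line with either group structure.
\<close>

definition C0 :: "(real \<Rightarrow>\<^sub>C 'a::real_normed_vector) set" where
  "C0 = {u. (apply_bcontfun u \<longlongrightarrow> 0) at_top \<and> (apply_bcontfun u \<longlongrightarrow> 0) at_bot}"


section \<open>Evolution families\<close>

text \<open>
  Only the values \<open>U t s\<close> with \<open>s \<le> t\<close> are relevant. The axioms involve only the order and
  the topology, so they are the same for both group structures.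
\<close>

definition evolution_family :: "(real \<Rightarrow> real \<Rightarrow> 'a::real_normed_vector \<Rightarrow>\<^sub>L 'a) \<Rightarrow> bool" where
  "evolution_family U \<longleftrightarrow>
     (\<forall>t. U t t = id_blinfun) \<and>
     (\<forall>t r s. s \<le> r \<and> r \<le> t \<longrightarrow> U t r o\<^sub>L U r s = U t s) \<and>
     (\<forall>x. continuous_on {(t, s). s \<le> t} (\<lambda>(t, s). blinfun_apply (U t s) x))"

definition h_bounded ::
  "(real \<Rightarrow> real) \<Rightarrow> (real \<Rightarrow> real \<Rightarrow> 'a::real_normed_vector \<Rightarrow>\<^sub>L 'a) \<Rightarrow> bool" where
  "h_bounded h U \<longleftrightarrow>
     (\<exists>\<alpha>>0. \<exists>K\<ge>1. \<forall>t s. s \<le> t \<longrightarrow> norm (U t s) \<le> K * (h t / h s) powr \<alpha>)"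


section \<open>Evolution semigroups and their generators\<close>

text \<open>
  \<^const>\<open>Bcontfun\<close> is meaningful only on bounded continuous functions; the lemmas
  \<open>h_semigroup_apply\<close>, \<open>evol_semigroup_apply\<close> and \<open>transport_apply\<close> below show that this is
  the case whenever the family is \<open>h\<close>-bounded and the argument lies in \<^const>\<open>C0\<close>.
\<close>

definition h_semigroup ::
  "(real \<Rightarrow> real) \<Rightarrow> (real \<Rightarrow> real \<Rightarrow> 'a::real_normed_vector \<Rightarrow>\<^sub>L 'a) \<Rightarrow>
   real \<Rightarrow> (real \<Rightarrow>\<^sub>C 'a) \<Rightarrow> (real \<Rightarrow>\<^sub>C 'a)" where
  "h_semigroup h U t u =
     Bcontfun (\<lambda>s. blinfun_apply (U s (hmult h s (hinv h t))) (apply_bcontfun u (hmult h s (hinv h t))))"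

definition evol_semigroup ::
  "(real \<Rightarrow> real \<Rightarrow> 'a::real_normed_vector \<Rightarrow>\<^sub>L 'a) \<Rightarrow>
   real \<Rightarrow> (real \<Rightarrow>\<^sub>C 'a) \<Rightarrow> (real \<Rightarrow>\<^sub>C 'a)" where
  "evol_semigroup V t v =
     Bcontfun (\<lambda>s. blinfun_apply (V s (s - t)) (apply_bcontfun v (s - t)))"

definition h_gen_dom ::
  "(real \<Rightarrow> real) \<Rightarrow> (real \<Rightarrow> (real \<Rightarrow>\<^sub>C 'a::real_normed_vector) \<Rightarrow> (real \<Rightarrow>\<^sub>C 'a)) \<Rightarrow>
   (real \<Rightarrow>\<^sub>C 'a) set" where
  "h_gen_dom h T =
     {w \<in> C0. \<exists>z\<in>C0. ((\<lambda>t. (T t w - w) /\<^sub>R ln (h t)) \<longlongrightarrow> z) (at_right (hunit h))}"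

definition h_gen ::
  "(real \<Rightarrow> real) \<Rightarrow> (real \<Rightarrow> (real \<Rightarrow>\<^sub>C 'a::real_normed_vector) \<Rightarrow> (real \<Rightarrow>\<^sub>C 'a)) \<Rightarrow>
   (real \<Rightarrow>\<^sub>C 'a) \<Rightarrow> (real \<Rightarrow>\<^sub>C 'a)" where
  "h_gen h T w = Lim (at_right (hunit h)) (\<lambda>t. (T t w - w) /\<^sub>R ln (h t))"

definition gen_dom ::
  "(real \<Rightarrow> (real \<Rightarrow>\<^sub>C 'a::real_normed_vector) \<Rightarrow> (real \<Rightarrow>\<^sub>C 'a)) \<Rightarrow> (real \<Rightarrow>\<^sub>C 'a) set" where
  "gen_dom S = {v \<in> C0. \<exists>z\<in>C0. ((\<lambda>t. (S t v - v) /\<^sub>R t) \<longlongrightarrow> z) (at_right 0)}"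

definition gen ::
  "(real \<Rightarrow> (real \<Rightarrow>\<^sub>C 'a::real_normed_vector) \<Rightarrow> (real \<Rightarrow>\<^sub>C 'a)) \<Rightarrow>
   (real \<Rightarrow>\<^sub>C 'a) \<Rightarrow> (real \<Rightarrow>\<^sub>C 'a)" where
  "gen S v = Lim (at_right 0) (\<lambda>t. (S t v - v) /\<^sub>R t)"

definition transport ::
  "(real \<Rightarrow> real) \<Rightarrow> (real \<Rightarrow>\<^sub>C 'a::real_normed_vector) \<Rightarrow> (real \<Rightarrow>\<^sub>C 'a)" where
  "transport h w = Bcontfun (apply_bcontfun w \<circ> inv (log_rate h))"

definition rescaled_family ::
  "(real \<Rightarrow> real) \<Rightarrow> (real \<Rightarrow> real \<Rightarrow> 'a::real_normed_vector \<Rightarrow>\<^sub>L 'a) \<Rightarrow>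
   real \<Rightarrow> real \<Rightarrow> 'a \<Rightarrow>\<^sub>L 'a" where
  "rescaled_family h U t s = U (inv (log_rate h) t) (inv (log_rate h) s)"


section \<open>Well-definedness\<close>

lemma growth_rateD:
  assumes "growth_rate h"
  shows "strict_mono h" "continuous_on UNIV h" "continuous_on {0<..} (inv h)"
    "h t > 0" "inv h (h t) = t" "y > 0 \<Longrightarrow> h (inv h y) = y"
    "(h a \<le> h b) = (a \<le> b)"
proof -
  show sm: "strict_mono h"
    using assms by (simp add: growth_rate_def)
  have hom: "homeomorphism UNIV {0<..} h (inv h)"
    using assms by (simp add: growth_rate_def)
  show "continuous_on UNIV h" "continuous_on {0<..} (inv h)" "inv h (h t) = t"
    "y > 0 \<Longrightarrow> h (inv h y) = y"
    using hom by (auto simp: homeomorphism_def)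
  have "h t \<in> {0<..}"
    using hom unfolding homeomorphism_def by blast
  then show "h t > 0" by simp
  show "(h a \<le> h b) = (a \<le> b)"
    using sm by (rule strict_mono_less_eq)
qed

lemma inv_log_rate:
  assumes "growth_rate h"
  shows "inv (log_rate h) = (\<lambda>s. inv h (exp s))"
proof
  fix s
  have "log_rate h (inv h (exp s)) = s"
    using growth_rateD(6)[OF assms] by (simp add: log_rate_def)
  moreover have "inj (log_rate h)"
    using growth_rateD(4,5)[OF assms] by (metis exp_ln injI log_rate_def)
  ultimately show "inv (log_rate h) s = inv h (exp s)"
    by (metis inv_f_f)
qed

lemma filterlim_mono_surj:
  fixes p :: "real \<Rightarrow> real"
  assumes "mono p" "surj p"
  shows "filterlim p at_top at_top" "filterlim p at_bot at_bot"
proof -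
  show "filterlim p at_top at_top"
    unfolding filterlim_at_top eventually_at_top_linorder
    using assms by (metis monoD surjD)
  show "filterlim p at_bot at_bot"
    unfolding filterlim_at_bot eventually_at_bot_linorder
    using assms by (metis monoD surjD)
qed

lemma evolution_operator_C0:
  fixes U :: "real \<Rightarrow> real \<Rightarrow> 'a::real_normed_vector \<Rightarrow>\<^sub>L 'a"
  assumes U: "evolution_family U" and u: "u \<in> C0"
    and p: "mono p" "surj p" "continuous_on UNIV p" "\<And>s. p s \<le> s"
    and M: "\<And>s. norm (U s (p s)) \<le> M"
  defines "f \<equiv> \<lambda>s. blinfun_apply (U s (p s)) (apply_bcontfun u (p s))"
  shows "f \<in> bcontfun" "Bcontfun f \<in> C0"
proof -
  have le: "norm (f s) \<le> M * norm (apply_bcontfun u (p s))" for s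
    unfolding f_def by (rule order_trans[OF norm_blinfun mult_right_mono[OF M]]) simp
  have M0: "M \<ge> 0"
    using M[of 0] norm_ge_zero order_trans by blast
  have "continuous_on UNIV f"
    unfolding continuous_on_def
  proof
    fix s0 :: real
    let ?x = "apply_bcontfun u (p s0)"
    have cu: "continuous_on UNIV (\<lambda>s. apply_bcontfun u (p s))"
      by (rule continuous_on_compose2[OF _ p(3)]) (auto intro: continuous_on_apply_bcontfun)
    have lim_u: "((\<lambda>s. apply_bcontfun u (p s)) \<longlongrightarrow> ?x) (at s0)"
      using cu by (simp add: continuous_on_def)
    have "continuous_on UNIV (\<lambda>s. case (s, p s) of (t, s) \<Rightarrow> blinfun_apply (U t s) ?x)"
      by (rule continuous_on_compose2[where t = "{(t, s). s \<le> t}" and f = "\<lambda>s. (s, p s)"])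
        (use U p in \<open>auto simp: evolution_family_def intro!: continuous_intros\<close>)
    then have 1: "((\<lambda>s. blinfun_apply (U s (p s)) ?x) \<longlongrightarrow> f s0) (at s0)"
      by (simp add: continuous_on_def f_def)
    have 2: "((\<lambda>s. blinfun_apply (U s (p s)) (apply_bcontfun u (p s) - ?x)) \<longlongrightarrow> 0) (at s0)"
    proof (rule Lim_null_comparison)
      show "\<forall>\<^sub>F s in at s0. norm (blinfun_apply (U s (p s)) (apply_bcontfun u (p s) - ?x))
          \<le> M * norm (apply_bcontfun u (p s) - ?x)"
        by (intro always_eventually allI order_trans[OF norm_blinfun mult_right_mono[OF M]]) simp
      show "((\<lambda>s. M * norm (apply_bcontfun u (p s) - ?x)) \<longlongrightarrow> 0) (at s0)"
        using lim_u by (intro tendsto_mult_right_zero tendsto_norm_zero) (simp add: LIM_zero_iff)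
    qed
    show "(f \<longlongrightarrow> f s0) (at s0 within UNIV)"
      using tendsto_add[OF 2 1] by (simp add: f_def blinfun.diff_right)
  qed
  moreover have "norm (f s) \<le> M * norm u" for s
    using le[of s] M0 by (meson mult_left_mono norm_bounded order_trans)
  ultimately show bc: "f \<in> bcontfun"
    by (auto simp: bcontfun_def intro: boundedI)
  have "(f \<longlongrightarrow> 0) F" if "filterlim p G F" "(apply_bcontfun u \<longlongrightarrow> 0) G" for F G
  proof (rule Lim_null_comparison)
    show "\<forall>\<^sub>F s in F. norm (f s) \<le> M * norm (apply_bcontfun u (p s))"
      using le by simp
    show "((\<lambda>s. M * norm (apply_bcontfun u (p s))) \<longlongrightarrow> 0) F"
      by (intro tendsto_mult_right_zero tendsto_norm_zero filterlim_compose[OF that(2,1)])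
  qed
  then show "Bcontfun f \<in> C0"
    using u filterlim_mono_surj[OF p(1,2)] by (auto simp: C0_def Bcontfun_inverse[OF bc])
qed

lemma h_semigroup_apply:
  assumes h: "growth_rate h" and U: "evolution_family U" "h_bounded h U"
    and u: "u \<in> C0" and t: "hunit h \<le> t"
  shows "apply_bcontfun (h_semigroup h U t u) s =
      blinfun_apply (U s (hmult h s (hinv h t))) (apply_bcontfun u (hmult h s (hinv h t)))"
    and "h_semigroup h U t u \<in> C0"
proof -
  note g = growth_rateD[OF h]
  define p where "p = (\<lambda>s. hmult h s (hinv h t))"
  have hp: "h (p s) = h s / h t" for s
    using g(4) by (simp add: p_def hmult_def hinv_def g(6))
  have t1: "h t \<ge> 1"
    using t g(6)[of 1] g(7)[of "hunit h" t] by (simp add: hunit_def)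
  have p1: "mono p"
  proof (rule monoI)
    fix a b :: real assume "a \<le> b"
    then have "h (p a) \<le> h (p b)"
      using g(4,7) by (simp add: hp divide_right_mono less_imp_le)
    then show "p a \<le> p b" by (simp add: g(7))
  qed
  have p2: "surj p"
  proof (rule surjI)
    fix y show "p (inv h (h y * h t)) = y"
      using g(4)[of y] g(4)[of t] hp[of "inv h (h y * h t)"] g(5) g(6)[of "h y * h t"]
      by (metis mult_pos_pos nonzero_mult_div_cancel_right less_irrefl)
  qed
  have p3: "continuous_on UNIV p"
    unfolding p_def hmult_def
    by (rule continuous_on_compose2[OF g(3)])
      (use g(4) less_imp_neq[OF g(4)[of t]] in \<open>auto simp: hinv_def g(6) intro!: continuous_intros g(2)\<close>)
  have p4: "p s \<le> s" for s
    using t1 g(4)[of s] g(7)[of "p s" s] by (simp add: hp field_simps)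
  obtain \<alpha> K where K: "\<And>t s. s \<le> t \<Longrightarrow> norm (U t s) \<le> K * (h t / h s) powr \<alpha>"
    using U(2) unfolding h_bounded_def by blast
  have M: "norm (U s (p s)) \<le> K * h t powr \<alpha>" for s
    using K[OF p4[of s]] g(4)[of s] g(4)[of t] by (simp add: hp)
  note * = evolution_operator_C0[OF U(1) u p1 p2 p3 p4 M]
  show "apply_bcontfun (h_semigroup h U t u) s =
      blinfun_apply (U s (hmult h s (hinv h t))) (apply_bcontfun u (hmult h s (hinv h t)))"
    "h_semigroup h U t u \<in> C0"
    using * by (simp_all add: p_def h_semigroup_def Bcontfun_inverse)
qed

lemma rescaled_family_evolution:
  assumes h: "growth_rate h" and U: "evolution_family U"
  shows "evolution_family (rescaled_family h U)"
proof -
  note g = growth_rateD[OF h]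
  have m: "inv h (exp a) \<le> inv h (exp b)" if "a \<le> b" for a b :: real
    using that g(7)[of "inv h (exp a)" "inv h (exp b)"] by (simp add: g(6))
  have "continuous_on {(t, s). s \<le> t} (\<lambda>z. blinfun_apply (rescaled_family h U (fst z) (snd z)) x)" for x
  proof -
    have *: "continuous_on {(t, s). s \<le> t} (\<lambda>z. (inv h (exp (fst z)), inv h (exp (snd z))))"
      by (intro continuous_on_Pair continuous_on_compose2[OF g(3)] continuous_intros) auto
    have "continuous_on {(t, s). s \<le> t} (\<lambda>z. (\<lambda>(t, s). blinfun_apply (U t s) x)
        (inv h (exp (fst z)), inv h (exp (snd z))))"
      by (rule continuous_on_compose2[OF _ *]) (use U m in \<open>auto simp: evolution_family_def\<close>)
    then show ?thesis
      by (simp add: rescaled_family_def inv_log_rate[OF h])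
  qed
  then show ?thesis
    using U m unfolding evolution_family_def
    by (auto simp: rescaled_family_def inv_log_rate[OF h] case_prod_beta)
qed

lemma evol_semigroup_apply:
  assumes h: "growth_rate h" and U: "evolution_family U" "h_bounded h U"
    and v: "v \<in> C0" and t: "0 \<le> t"
  defines "V \<equiv> rescaled_family h U"
  shows "apply_bcontfun (evol_semigroup V t v) s = blinfun_apply (V s (s - t)) (apply_bcontfun v (s - t))"
    and "evol_semigroup V t v \<in> C0"
proof -
  note g = growth_rateD[OF h]
  obtain \<alpha> K where K: "\<And>t s. s \<le> t \<Longrightarrow> norm (U t s) \<le> K * (h t / h s) powr \<alpha>"
    using U(2) unfolding h_bounded_def by blast
  have M: "norm (V s (s - t)) \<le> K * exp t powr \<alpha>" for s
  proof -
    have "inv h (exp (s - t)) \<le> inv h (exp s)"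
      using t g(7)[of "inv h (exp (s - t))" "inv h (exp s)"] by (simp add: g(6))
    from K[OF this] show ?thesis
      by (simp add: V_def rescaled_family_def inv_log_rate[OF h] g(6) exp_diff)
  qed
  have p: "mono (\<lambda>s. s - t)" "surj (\<lambda>s. s - t)" "continuous_on UNIV (\<lambda>s. s - t)" "\<And>s. s - t \<le> s"
    using t by (auto intro!: monoI continuous_intros surjI[where f = "\<lambda>s. s + t"])
  note * = evolution_operator_C0[OF rescaled_family_evolution[OF h U(1), folded V_def] v p M]
  show "apply_bcontfun (evol_semigroup V t v) s = blinfun_apply (V s (s - t)) (apply_bcontfun v (s - t))"
    "evol_semigroup V t v \<in> C0"
    using * by (simp_all add: evol_semigroup_def Bcontfun_inverse)
qed

lemma transport_apply:
  assumes h: "growth_rate h" and w: "w \<in> C0"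
  shows "apply_bcontfun (transport h w) = apply_bcontfun w \<circ> inv (log_rate h)"
    and "transport h w \<in> C0"
proof -
  note g = growth_rateD[OF h]
  let ?p = "inv (log_rate h)"
  have p: "mono ?p" "surj ?p" "continuous_on UNIV ?p"
  proof -
    show "mono ?p"
    proof (rule monoI)
      fix a b :: real assume "a \<le> b"
      then show "?p a \<le> ?p b"
        using g(7)[of "inv h (exp a)" "inv h (exp b)"] by (simp add: inv_log_rate[OF h] g(6))
    qed
    show "surj ?p"
      by (rule surjI[where f = "log_rate h"])
        (simp add: inv_log_rate[OF h] log_rate_def g(4,5))
    show "continuous_on UNIV ?p"
      unfolding inv_log_rate[OF h]
      by (rule continuous_on_compose2[OF g(3)]) (auto intro!: continuous_intros)
  qed
  have "continuous_on UNIV (apply_bcontfun w \<circ> ?p)"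
    using p(3) by (intro continuous_on_compose) (auto intro: continuous_on_apply_bcontfun)
  moreover have "bounded (range (apply_bcontfun w \<circ> ?p))"
    by (rule boundedI[where B = "norm w"]) (auto simp: norm_bounded)
  ultimately have bc: "apply_bcontfun w \<circ> ?p \<in> bcontfun"
    by (simp add: bcontfun_def)
  then show eq: "apply_bcontfun (transport h w) = apply_bcontfun w \<circ> ?p"
    by (simp add: transport_def Bcontfun_inverse)
  show "transport h w \<in> C0"
    using w filterlim_mono_surj[OF p(1,2)]
    by (auto simp: C0_def eq comp_def intro: filterlim_compose)
qed

end

theory Submission
  imports Defs
begin

text \<open>
  Composition with \<open>\<mu>\<inverse>\<close> is a linear isometry that maps \<^const>\<open>C0\<close> onto itself and intertwines
  \<open>T\<^sub>t\<close> with \<open>S\<^sub>s\<close> for \<open>s = \<mu> t\<close>. It therefore carries the difference quotient of \<open>T\<close> at \<open>t\<close> to that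
  of \<open>S\<close> at \<open>\<mu> t\<close>, and as \<open>\<mu>\<close> maps right neighbourhoods of \<open>e\<^sub>*\<close> to right neighbourhoods of \<open>0\<close>,
  one quotient converges iff the other one does.
\<close>

text \<open>The inverse of \<open>log_rate h\<close> is used in the explicit form
  \<open>inv h (exp s)\<close>, so that both cancellation laws can serve as rewrite rules.\<close>

lemma log_rate_inv [simp]:
  assumes "growth_rate h"
  shows "log_rate h (inv h (exp s)) = s" "inv h (exp (log_rate h t)) = t"
  using growth_rateD(4-6)[OF assms] by (simp_all add: log_rate_def)

lemma continuous_on_log_rate:
  assumes "growth_rate h"
  shows "continuous_on UNIV (log_rate h)"
  unfolding log_rate_def
  using growth_rateD(2,4)[OF assms] by (auto intro!: continuous_intros simp: less_imp_neq[symmetric])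

lemma continuous_on_inv_log_rate:
  assumes "growth_rate h"
  shows "continuous_on UNIV (\<lambda>s. inv h (exp s))"
  by (rule continuous_on_compose2[OF growth_rateD(3)[OF assms]]) (auto intro!: continuous_intros)

lemma log_rate_less_iff:
  assumes "growth_rate h"
  shows "log_rate h a < log_rate h b \<longleftrightarrow> a < b"
  using growth_rateD(1,4)[OF assms] by (simp add: log_rate_def strict_mono_less)

lemma log_rate_hunit:
  assumes "growth_rate h"
  shows "log_rate h (hunit h) = 0"
  using growth_rateD(6)[OF assms, of 1] by (simp add: log_rate_def hunit_def)

text \<open>Continuity gives the limit at the endpoint, and strict monotonicity keeps the values
  strictly to its right.\<close>

lemma filterlim_at_right_log_rate:
  assumes h: "growth_rate h"
  shows "filterlim (log_rate h) (at_right 0) (at_right (hunit h))"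
    and "filterlim (\<lambda>s. inv h (exp s)) (at_right (hunit h)) (at_right 0)"
proof -
  have "(log_rate h \<longlongrightarrow> log_rate h (hunit h)) (at_right (hunit h))"
    using continuous_on_log_rate[OF h]
    by (auto simp: continuous_on_def intro: tendsto_within_subset)
  moreover have "\<forall>\<^sub>F t in at_right (hunit h). 0 < log_rate h t"
    using log_rate_less_iff[OF h, of "hunit h"]
    by (auto simp: log_rate_hunit[OF h] eventually_at_filter)
  ultimately show "filterlim (log_rate h) (at_right 0) (at_right (hunit h))"
    by (simp add: filterlim_at log_rate_hunit[OF h] eventually_mono)
  \<comment> \<open>Since \<open>exp 0 = 1\<close>, this limit is \<open>hunit h\<close>.\<close>
  have "((\<lambda>s. inv h (exp s)) \<longlongrightarrow> inv h (exp 0)) (at_right 0)"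
    using continuous_on_inv_log_rate[OF h]
    unfolding continuous_on_def by (blast intro: tendsto_within_subset)
  moreover have "\<forall>\<^sub>F s in at_right 0. hunit h < inv h (exp s)"
    using log_rate_less_iff[OF h, of "hunit h" "inv h (exp s)" for s]
    by (simp add: log_rate_hunit[OF h] h eventually_at_filter)
  ultimately show "filterlim (\<lambda>s. inv h (exp s)) (at_right (hunit h)) (at_right 0)"
    by (auto simp: filterlim_at hunit_def elim: eventually_mono)
qed

lemma tendsto_log_rate_iff:
  assumes h: "growth_rate h"
  shows "((\<lambda>t. f (log_rate h t)) \<longlongrightarrow> l) (at_right (hunit h)) \<longleftrightarrow> (f \<longlongrightarrow> l) (at_right 0)"
proof
  assume "((\<lambda>t. f (log_rate h t)) \<longlongrightarrow> l) (at_right (hunit h))"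
  from filterlim_compose[OF this filterlim_at_right_log_rate(2)[OF h]]
  show "(f \<longlongrightarrow> l) (at_right 0)"
    by (simp add: h)
next
  assume "(f \<longlongrightarrow> l) (at_right 0)"
  then show "((\<lambda>t. f (log_rate h t)) \<longlongrightarrow> l) (at_right (hunit h))"
    by (rule filterlim_compose[OF _ filterlim_at_right_log_rate(1)[OF h]])
qed

text \<open>Ensures that \<open>Bcontfun\<close> is applied to a bounded continuous function, both
  in \<open>transport h\<close> and in its inverse, composition with
  \<open>log_rate h\<close>.\<close>

lemma bcontfun_comp:
  fixes w :: "'b::topological_space \<Rightarrow>\<^sub>C 'c::real_normed_vector"
  assumes "continuous_on UNIV p"
  shows "(\<lambda>s. apply_bcontfun w (p s)) \<in> bcontfun"
proof -
  have "continuous_on UNIV (\<lambda>s. apply_bcontfun w (p s))"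
    by (rule continuous_on_compose2[OF _ assms]) (auto intro: continuous_on_apply_bcontfun)
  moreover have "bounded (range (\<lambda>s. apply_bcontfun w (p s)))"
    by (rule boundedI[where B = "norm w"]) (auto simp: norm_bounded)
  ultimately show ?thesis
    by (simp add: bcontfun_def)
qed

lemma apply_transport:
  assumes h: "growth_rate h"
  shows "apply_bcontfun (transport h w) s = apply_bcontfun w (inv h (exp s))"
  using bcontfun_comp[OF continuous_on_inv_log_rate[OF h], of w]
  by (simp add: transport_def inv_log_rate[OF h] comp_def Bcontfun_inverse)

lemma transport_diff:
  assumes "growth_rate h"
  shows "transport h (v - w) = transport h v - transport h w"
  by (rule bcontfun_eqI) (simp add: apply_transport[OF assms])

lemma transport_scaleR:
  assumes "growth_rate h"
  shows "transport h (c *\<^sub>R w) = c *\<^sub>R transport h w"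
  by (rule bcontfun_eqI) (simp add: apply_transport[OF assms])

text \<open>Reparametrizing by a bijection of the line leaves the set of pointwise distances
  unchanged, hence also its supremum.\<close>

lemma dist_transport:
  assumes h: "growth_rate h"
  shows "dist (transport h v) (transport h w) = dist v w"
proof (rule antisym)
  show "dist (transport h v) (transport h w) \<le> dist v w"
    by (rule dist_bound) (simp add: apply_transport[OF h] dist_bounded)
  show "dist v w \<le> dist (transport h v) (transport h w)"
  proof (rule dist_bound)
    fix t
    show "dist (apply_bcontfun v t) (apply_bcontfun w t) \<le> dist (transport h v) (transport h w)"
      \<comment> \<open>The values of \<open>v\<close> and \<open>w\<close> at \<open>t\<close> are
        those of their transports at \<open>log_rate h t\<close>.\<close>
      using dist_bounded[of "transport h v" "log_rate h t" "transport h w"]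
      by (simp add: apply_transport[OF h] h)
  qed
qed

lemma tendsto_transport_iff:
  assumes "growth_rate h"
  shows "((\<lambda>t. transport h (f t)) \<longlongrightarrow> transport h z) F \<longleftrightarrow> (f \<longlongrightarrow> z) F"
  by (simp add: tendsto_iff dist_transport[OF assms])

lemma inj_transport:
  assumes "growth_rate h"
  shows "inj (transport h)"
  by (rule injI) (metis assms dist_transport dist_eq_0_iff)

text \<open>The preimage is \<open>z\<close> composed with \<open>log_rate h\<close>. It vanishes at
  both ends because a monotone surjection of the line tends to each infinity along with its
  argument.\<close>

lemma transport_surj:
  assumes h: "growth_rate h" and z: "z \<in> C0"
  obtains w where "w \<in> C0" "transport h w = z"
proof
  let ?w = "Bcontfun (\<lambda>t. apply_bcontfun z (log_rate h t))"
  have app: "apply_bcontfun ?w = (\<lambda>t. apply_bcontfun z (log_rate h t))"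
    by (rule Bcontfun_inverse[OF bcontfun_comp[OF continuous_on_log_rate[OF h]]])
  have "mono (log_rate h)"
    using log_rate_less_iff[OF h] by (auto intro!: monoI simp flip: not_less)
  moreover have "surj (log_rate h)"
    by (rule surjI) (rule log_rate_inv(1)[OF h])
  ultimately show "?w \<in> C0"
    using z filterlim_mono_surj[of "log_rate h"]
    by (auto simp: C0_def app intro: filterlim_compose)
  show "transport h ?w = z"
    by (rule bcontfun_eqI) (simp add: apply_transport[OF h] app h)
qed

text \<open>The logarithm of \<open>h\<close> is an isomorphism from the group law of
  \<open>h\<close> to addition, so the shift by the inverse of \<open>t\<close> becomes subtraction
  of \<open>log_rate h t\<close>.\<close>

lemma transport_h_semigroup:
  assumes h: "growth_rate h" and U: "evolution_family U" "h_bounded h U"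
    and w: "w \<in> C0" and t: "hunit h \<le> t"
  shows "transport h (h_semigroup h U t w) =
    evol_semigroup (rescaled_family h U) (log_rate h t) (transport h w)"
proof (rule bcontfun_eqI)
  fix s
  note g = growth_rateD[OF h]
  have *: "hmult h (inv h (exp s)) (hinv h t) = inv h (exp (s - log_rate h t))"
    using g(4)[of t] by (simp add: hmult_def hinv_def g(6) log_rate_def exp_diff)
  have "0 \<le> log_rate h t"
    using t log_rate_less_iff[OF h, of t "hunit h"] by (simp add: log_rate_hunit[OF h] flip: not_less)
  note S = evol_semigroup_apply(1)[OF h U transport_apply(2)[OF h w] this]
  show "apply_bcontfun (transport h (h_semigroup h U t w)) s =
    apply_bcontfun (evol_semigroup (rescaled_family h U) (log_rate h t) (transport h w)) s"
    by (simp add: S apply_transport[OF h] h_semigroup_apply(1)[OF h U w t] *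
        rescaled_family_def inv_log_rate[OF h])
qed

lemma tendsto_quotient_iff:
  assumes h: "growth_rate h" and U: "evolution_family U" "h_bounded h U" and w: "w \<in> C0"
  defines "S \<equiv> evol_semigroup (rescaled_family h U)"
  shows "((\<lambda>t. (h_semigroup h U t w - w) /\<^sub>R ln (h t)) \<longlongrightarrow> z) (at_right (hunit h)) \<longleftrightarrow>
    ((\<lambda>t. (S t (transport h w) - transport h w) /\<^sub>R t) \<longlongrightarrow> transport h z) (at_right 0)"
proof -
  let ?Q = "\<lambda>t. (S t (transport h w) - transport h w) /\<^sub>R t"
  \<comment> \<open>The intertwining relation is available for \<open>hunit h \<le> t\<close>, which
    holds throughout the right-sided filter. The denominator \<open>ln (h t)\<close> is exactly the
    new time \<open>log_rate h t\<close>.\<close>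
  have "\<forall>\<^sub>F t in at_right (hunit h).
      transport h ((h_semigroup h U t w - w) /\<^sub>R ln (h t)) = ?Q (log_rate h t)"
    by (auto simp: eventually_at_filter transport_diff[OF h] transport_scaleR[OF h]
        transport_h_semigroup[OF h U w] S_def log_rate_def)
  then have "((\<lambda>t. transport h ((h_semigroup h U t w - w) /\<^sub>R ln (h t))) \<longlongrightarrow> transport h z)
      (at_right (hunit h)) \<longleftrightarrow> ((\<lambda>t. ?Q (log_rate h t)) \<longlongrightarrow> transport h z) (at_right (hunit h))"
    by (rule tendsto_cong)
  then show ?thesis
    by (simp only: tendsto_transport_iff[OF h] tendsto_log_rate_iff[OF h, where f = ?Q])
qed

theorem theorem1:
  fixes h :: "real \<Rightarrow> real"
    and U :: "real \<Rightarrow> real \<Rightarrow> 'a::banach \<Rightarrow>\<^sub>L 'a"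
  defines "\<mu> \<equiv> log_rate h"
    and "\<F> \<equiv> transport h"
    and "B \<equiv> h_gen h (h_semigroup h U)"
    and "DB \<equiv> h_gen_dom h (h_semigroup h U)"
    and "A \<equiv> gen (evol_semigroup (rescaled_family h U))"
    and "DA \<equiv> gen_dom (evol_semigroup (rescaled_family h U))"
  assumes "growth_rate h"
    and "evolution_family U"
    and "h_bounded h U"
  shows "DB = {w \<in> C0. \<F> w \<in> DA} \<and>
    (\<forall>w\<in>DB. B w = inv_into C0 \<F> (A (\<F> w)) \<and>
              apply_bcontfun (B w) = apply_bcontfun (A (\<F> w)) \<circ> \<mu>)"
proof (intro conjI ballI)
  note h = \<open>growth_rate h\<close>
  note lim = tendsto_quotient_iff[OF h \<open>evolution_family U\<close> \<open>h_bounded h U\<close>]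
  show "DB = {w \<in> C0. \<F> w \<in> DA}"
  proof (intro set_eqI iffI)
    fix w assume "w \<in> DB"
    then show "w \<in> {w \<in> C0. \<F> w \<in> DA}"
      using lim transport_apply(2)[OF h]
      unfolding DB_def h_gen_dom_def DA_def gen_dom_def \<F>_def by blast
  next
    fix w assume w: "w \<in> {w \<in> C0. \<F> w \<in> DA}"
    then obtain y where y: "y \<in> C0"
        "((\<lambda>t. (evol_semigroup (rescaled_family h U) t (transport h w) - transport h w) /\<^sub>R t)
          \<longlongrightarrow> y) (at_right 0)"
      unfolding DA_def gen_dom_def \<F>_def by blast
    \<comment> \<open>The domain of \<open>A\<close> only provides a limit \<open>y\<close> in
      \<open>C0\<close>; the equivalence of the quotients requires it in the form
      \<open>transport h z\<close>.\<close>
    obtain z where "z \<in> C0" "transport h z = y"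
      using transport_surj[OF h y(1)] .
    then show "w \<in> DB"
      using lim w y(2) unfolding DB_def h_gen_dom_def by blast
  qed
  fix w assume "w \<in> DB"
  then obtain z where w: "w \<in> C0" and z: "z \<in> C0"
      "((\<lambda>t. (h_semigroup h U t w - w) /\<^sub>R ln (h t)) \<longlongrightarrow> z) (at_right (hunit h))"
    unfolding DB_def h_gen_dom_def by blast
  \<comment> \<open>Limits along the nontrivial right-sided filter are unique, so \<open>Lim\<close>
    returns the limit already found.\<close>
  have B: "B w = z"
    unfolding B_def h_gen_def by (rule tendsto_Lim[OF _ z(2)]) simp
  have A: "A (\<F> w) = \<F> z"
    unfolding A_def gen_def \<F>_def by (rule tendsto_Lim[OF _ lim[OF w, THEN iffD1, OF z(2)]]) simp
  \<comment> \<open>With \<open>z\<close> in \<open>C0\<close>, injectivity forces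
    \<open>inv_into\<close> to return \<open>z\<close> itself.\<close>
  have "inj_on \<F> C0"
    using inj_transport[OF h] unfolding \<F>_def by (rule inj_on_subset) simp
  then show "B w = inv_into C0 \<F> (A (\<F> w))"
    by (simp add: A B z(1))
  show "apply_bcontfun (B w) = apply_bcontfun (A (\<F> w)) \<circ> \<mu>"
    unfolding A B by (rule ext) (simp add: \<F>_def \<mu>_def apply_transport[OF h] h)
qed

end
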